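(* Let $\lambda,\mu\in\mathbb{R}$ and let $s\ge 2$ be an integer. For each $k=0,\dots,2s-3$ the following recursion formula holds for all $x$: $$A_k\, p_{2s+1,k+4}(x)=x^2\, p_{2s-3,k}(x)-(k+1)(k+2)\,p_{2s-1,k+2}(x)+B_k\, x\, p_{2s-1,k+2}(x),$$ where the constants $A_k$ and $B_k$ are defined by $$B_k=\frac{k+2}{k+3}\left((k+1)\,p_{2s-1,k+2}^{(k+3)}(0)-(k+3)\,p_{2s-3,k}^{(k+1)}(0)\right),$$ $$A_k=(k+3)(k+4)\,p_{2s-3,k}^{(k+2)}(0)-(k+1)(k+2)\,p_{2s-1,k+2}^{(k+4)}(0)+(k+4)\,p_{2s-1,k+2}^{(k+3)}(0)\,B_k.$$
   Context: For a vector $\Lambda_n=(\lambda_0,\dots,\lambda_n)\in\mathbb{R}^{n+1}$, $E_{\Lambda_n}$ is the $(n+1)$-dimensional space of all $f\in C^\infty(\mathbb{R},\mathbb{C})$ with $\left(\frac{d}{dx}-\lambda_0\right)\cdots\left(\frac{d}{dx}-\lambda_n\right)f=0$. For $k=0,\dots,n$, $p_{\Lambda_n,k}$ denotes the unique element of $E_{\Lambda_n}$ having a zero of exact order $k$ at $0$, a zero of exact order $n-k$ at $1$, and normalized by $p_{\Lambda_n,k}^{(k)}(0)=1$ (it exists because the $\lambda_j$ are real). A zero of exact order $k$ at $a$ means $f(a)=\dots=f^{(k-1)}(a)=0$ and $f^{(k)}(a)\ne0$. For each integer $m\ge 0$ put $\Lambda_{2m+1}:=(\lambda\ (m+1\text{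 times}),\ \mu\ (m+1\text{ times}))$ and $p_{2m+1,k}:=p_{\Lambda_{2m+1},k}$, $k=0,\dots,2m+1$. *)

theory Defs
  imports "HOL-Analysis.Analysis"
begin

definition nth_vderiv :: "nat \<Rightarrow> (real \<Rightarrow> complex) \<Rightarrow> real \<Rightarrow> complex" where
  "nth_vderiv j = (\<lambda>f x. vector_derivative f (at x)) ^^ j"

definition smooth :: "(real \<Rightarrow> complex) \<Rightarrow> bool" where
  "smooth f \<longleftrightarrow> (\<forall>j x. nth_vderiv j f differentiable (at x))"

definition shifted_deriv :: "real \<Rightarrow> (real \<Rightarrow> complex) \<Rightarrow> real \<Rightarrow> complex" where
  "shifted_deriv l f = (\<lambda>x. vector_derivative f (at x) - of_real l * f x)"

text \<open>A vector \<open>(\<lambda>\<^sub>0, \<dots>, \<lambda>\<^sub>n)\<close> is given as a list of length \<open>n + 1\<close>, and \<open>foldr\<close> composes the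
  operators \<open>(d/dx - \<lambda>\<^sub>0) \<circ> \<dots> \<circ> (d/dx - \<lambda>\<^sub>n)\<close>.\<close>

definition exp_poly_space :: "real list \<Rightarrow> (real \<Rightarrow> complex) set" where
  "exp_poly_space L = {f. smooth f \<and> (\<forall>x. foldr shifted_deriv L f x = 0)}"

definition zero_of_exact_order :: "(real \<Rightarrow> complex) \<Rightarrow> real \<Rightarrow> nat \<Rightarrow> bool" where
  "zero_of_exact_order f a k \<longleftrightarrow> (\<forall>j<k. nth_vderiv j f a = 0) \<and> nth_vderiv k f a \<noteq> 0"

text \<open>Here \<open>n = length L - 1\<close>; only meaningful for \<open>L \<noteq> []\<close> and \<open>k \<le> n\<close>, because of truncated
  subtraction.\<close>

definition basis_fun :: "real list \<Rightarrow> nat \<Rightarrow> real \<Rightarrow> complex" where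
  "basis_fun L k = (THE f. f \<in> exp_poly_space L \<and>
      zero_of_exact_order f 0 k \<and>
      zero_of_exact_order f 1 (length L - 1 - k) \<and>
      nth_vderiv k f 0 = 1)"

text \<open>\<open>p_odd \<lambda> \<mu> m k\<close> is \<open>p\<^bsub>2m+1,k\<^esub>\<close>; the third argument is \<open>m\<close>, not \<open>2m+1\<close>. So for \<open>s \<ge> 2\<close>,
  \<open>p\<^bsub>2s+1,k\<^esub>\<close>, \<open>p\<^bsub>2s-1,k\<^esub>\<close>, \<open>p\<^bsub>2s-3,k\<^esub>\<close> are obtained with \<open>m = s, s - 1, s - 2\<close>.\<close>

definition p_odd :: "real \<Rightarrow> real \<Rightarrow> nat \<Rightarrow> nat \<Rightarrow> real \<Rightarrow> complex" where
  "p_odd lam mu m k = basis_fun (replicate (m + 1) lam @ replicate (m + 1) mu) k"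

definition B_const :: "real \<Rightarrow> real \<Rightarrow> nat \<Rightarrow> nat \<Rightarrow> complex" where
  "B_const lam mu s k =
     of_nat (k + 2) / of_nat (k + 3) *
       (of_nat (k + 1) * nth_vderiv (k + 3) (p_odd lam mu (s - 1) (k + 2)) 0
        - of_nat (k + 3) * nth_vderiv (k + 1) (p_odd lam mu (s - 2) k) 0)"

definition A_const :: "real \<Rightarrow> real \<Rightarrow> nat \<Rightarrow> nat \<Rightarrow> complex" where
  "A_const lam mu s k =
     of_nat ((k + 3) * (k + 4)) * nth_vderiv (k + 2) (p_odd lam mu (s - 2) k) 0
     - of_nat ((k + 1) * (k + 2)) * nth_vderiv (k + 4) (p_odd lam mu (s - 1) (k + 2)) 0
     + of_nat (k + 4) * nth_vderiv (k + 3) (p_odd lam mu (s - 1) (k + 2)) 0 * B_const lam mu s k"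

end

theory Submission
  imports Defs
begin

text \<open>Both sides lie in the solution space for \<open>\<Lambda>\<^bsub>2s+1\<^esub>\<close>, since multiplication by \<open>x\<close> raises each
  multiplicity by at most one. The constants are chosen so that the difference of the two sides
  vanishes to order \<open>k + 5\<close> at \<open>0\<close>; it also vanishes to order \<open>2s - 3 - k\<close> at \<open>1\<close>. These are
  \<open>2s + 2\<close> zeros, as many as the dimension of the space, so a Rolle argument applied to
  \<open>exp (- l x) * f x\<close> makes the difference zero. The same zero count gives uniqueness of the basis
  functions; their existence follows by solving \<open>f' - l f = g\<close>, where \<open>g\<close> is a combination of two
  basis functions of the shorter list with \<open>\<integral>\<^sub>0\<^sup>1 exp (- l t) g t dt = 0\<close>.\<close>

section \<open>Smooth functions\<close>

lemma nth_vderiv_0 [simp]: "nth_vderiv 0 f = f"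
  by (simp add: nth_vderiv_def)

lemma nth_vderiv_Suc: "nth_vderiv (Suc j) f = (\<lambda>x. vector_derivative (nth_vderiv j f) (at x))"
  by (simp add: nth_vderiv_def)

lemma smooth_has_vderiv:
  "smooth f \<Longrightarrow> (nth_vderiv j f has_vector_derivative nth_vderiv (Suc j) f x) (at x)"
  unfolding nth_vderiv_Suc smooth_def by (simp add: vector_derivative_works)

lemma smooth_has_vderiv_0:
  "smooth f \<Longrightarrow> (f has_vector_derivative nth_vderiv 1 f x) (at x)"
  using smooth_has_vderiv[of f 0 x] by simp

text \<open>Smoothness is proved by exhibiting a whole sequence \<open>F\<close> of successive
  derivatives; the closure rules below and the regularity of ODE solutions all come from
  this.\<close>

lemma
  assumes "\<And>j x. (F j has_vector_derivative F (Suc j) x) (at x)"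
  shows smooth_family: "smooth (F 0)" and nth_vderiv_family: "nth_vderiv j (F 0) = F j"
proof -
  have *: "nth_vderiv i (F 0) = F i" for i
    by (induction i) (auto simp: nth_vderiv_Suc intro!: vector_derivative_at assms)
  show "nth_vderiv j (F 0) = F j" by (rule *)
  show "smooth (F 0)"
    unfolding smooth_def * using assms differentiableI_vector by blast
qed

lemma
  assumes "smooth f" "smooth g"
  shows smooth_add: "smooth (\<lambda>x. f x + g x)"
    and nth_vderiv_add:
      "nth_vderiv j (\<lambda>x. f x + g x) = (\<lambda>x. nth_vderiv j f x + nth_vderiv j g x)"
proof -
  have der: "((\<lambda>x. nth_vderiv j f x + nth_vderiv j g x) has_vector_derivative
      nth_vderiv (Suc j) f x + nth_vderiv (Suc j) g x) (at x)" for j x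
    by (intro has_vector_derivative_add smooth_has_vderiv assms)
  show "smooth (\<lambda>x. f x + g x)"
    using smooth_family[of "\<lambda>j x. nth_vderiv j f x + nth_vderiv j g x", OF der] by simp
  show "nth_vderiv j (\<lambda>x. f x + g x) = (\<lambda>x. nth_vderiv j f x + nth_vderiv j g x)"
    using nth_vderiv_family[of "\<lambda>j x. nth_vderiv j f x + nth_vderiv j g x", OF der] by simp
qed

lemma
  assumes "smooth f"
  shows smooth_cmult: "smooth (\<lambda>x. c * f x)"
    and nth_vderiv_cmult: "nth_vderiv j (\<lambda>x. c * f x) = (\<lambda>x. c * nth_vderiv j f x)"
proof -
  have der: "((\<lambda>x. c * nth_vderiv j f x) has_vector_derivative c * nth_vderiv (Suc j) f x) (at x)"
    for j x
    by (intro has_vector_derivative_mult_right smooth_has_vderiv assms)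
  show "smooth (\<lambda>x. c * f x)"
    using smooth_family[of "\<lambda>j x. c * nth_vderiv j f x", OF der] by simp
  show "nth_vderiv j (\<lambda>x. c * f x) = (\<lambda>x. c * nth_vderiv j f x)"
    using nth_vderiv_family[of "\<lambda>j x. c * nth_vderiv j f x", OF der] by simp
qed

lemma
  assumes "smooth f"
  shows smooth_mult_x: "smooth (\<lambda>x. of_real x * f x)"
    and nth_vderiv_mult_x: "nth_vderiv j (\<lambda>x. of_real x * f x) =
      (\<lambda>x. of_real x * nth_vderiv j f x + of_nat j * nth_vderiv (j - 1) f x)"
proof -
  \<comment> \<open>Leibniz rule with two terms, as \<open>x\<close> has zero second derivative. At
    \<open>j = 0\<close> the truncated index \<open>j - 1\<close> is harmless: its coefficient is
    0.\<close>
  define F where "F = (\<lambda>j (x::real). of_real x * nth_vderiv j f x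
    + of_nat j * nth_vderiv (j - 1) f x)"
  have der: "(F j has_vector_derivative F (Suc j) x) (at x)" for j x
  proof -
    have "((\<lambda>x. of_real x * nth_vderiv j f x) has_vector_derivative
        of_real x * nth_vderiv (Suc j) f x + 1 * nth_vderiv j f x) (at x)"
      by (intro has_vector_derivative_mult smooth_has_vderiv assms)
        (auto intro!: derivative_eq_intros)
    moreover have "((\<lambda>x. of_nat j * nth_vderiv (j - 1) f x) has_vector_derivative
        of_nat j * nth_vderiv j f x) (at x)"
      using smooth_has_vderiv[OF assms, of "j - 1" x]
      by (cases j) (auto intro!: has_vector_derivative_mult_right)
    ultimately show ?thesis
      unfolding F_def by (auto dest: has_vector_derivative_add simp: algebra_simps)
  qed
  have F0: "F 0 = (\<lambda>x. of_real x * f x)" by (simp add: F_def)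
  show "smooth (\<lambda>x. of_real x * f x)" using smooth_family[of F] der F0 by simp
  show "nth_vderiv j (\<lambda>x. of_real x * f x) =
      (\<lambda>x. of_real x * nth_vderiv j f x + of_nat j * nth_vderiv (j - 1) f x)"
    using nth_vderiv_family[of F j] der F0 by (simp add: F_def)
qed

section \<open>The operators \<open>d/dx - l\<close>\<close>

lemma shifted_deriv_eq: "shifted_deriv l f = (\<lambda>x. nth_vderiv 1 f x - of_real l * f x)"
  by (simp add: shifted_deriv_def nth_vderiv_def)

lemma
  assumes "smooth f"
  shows smooth_shifted_deriv: "smooth (shifted_deriv l f)"
    and nth_vderiv_shifted_deriv: "nth_vderiv j (shifted_deriv l f) =
      (\<lambda>x. nth_vderiv (Suc j) f x - of_real l * nth_vderiv j f x)"
proof -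
  have der: "((\<lambda>x. nth_vderiv (Suc j) f x - of_real l * nth_vderiv j f x) has_vector_derivative
      nth_vderiv (Suc (Suc j)) f x - of_real l * nth_vderiv (Suc j) f x) (at x)" for j x
    by (intro has_vector_derivative_diff has_vector_derivative_mult_right smooth_has_vderiv assms)
  show "smooth (shifted_deriv l f)"
    using smooth_family[of "\<lambda>j x. nth_vderiv (Suc j) f x - of_real l * nth_vderiv j f x", OF der]
    by (simp add: shifted_deriv_eq)
  show "nth_vderiv j (shifted_deriv l f) =
      (\<lambda>x. nth_vderiv (Suc j) f x - of_real l * nth_vderiv j f x)"
    using nth_vderiv_family[of "\<lambda>j x. nth_vderiv (Suc j) f x - of_real l * nth_vderiv j f x", OF der]
    by (simp add: shifted_deriv_eq)
qed

lemma shifted_deriv_zero [simp]: "shifted_deriv l (\<lambda>x. 0) = (\<lambda>x. 0)"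
  by (simp add: shifted_deriv_def)

lemma foldr_shifted_deriv_zero [simp]: "foldr shifted_deriv L (\<lambda>x. 0) = (\<lambda>x. 0)"
  by (induction L) auto

lemma shifted_deriv_add:
  "smooth f \<Longrightarrow> smooth g \<Longrightarrow>
    shifted_deriv l (\<lambda>x. f x + g x) = (\<lambda>x. shifted_deriv l f x + shifted_deriv l g x)"
  by (simp add: shifted_deriv_eq nth_vderiv_add algebra_simps)

lemma shifted_deriv_cmult:
  "smooth f \<Longrightarrow> shifted_deriv l (\<lambda>x. c * f x) = (\<lambda>x. c * shifted_deriv l f x)"
  by (simp add: shifted_deriv_eq nth_vderiv_cmult algebra_simps)

lemma shifted_deriv_mult_x:
  "smooth f \<Longrightarrow>
    shifted_deriv l (\<lambda>x. of_real x * f x) = (\<lambda>x. of_real x * shifted_deriv l f x + f x)"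
  by (simp add: shifted_deriv_eq nth_vderiv_mult_x algebra_simps)

lemma shifted_deriv_commute:
  "smooth f \<Longrightarrow> shifted_deriv l (shifted_deriv m f) = shifted_deriv m (shifted_deriv l f)"
  by (simp add: shifted_deriv_eq[of _ "shifted_deriv _ _"] nth_vderiv_shifted_deriv)
    (simp add: shifted_deriv_eq algebra_simps)

lemma smooth_foldr_shifted_deriv: "smooth f \<Longrightarrow> smooth (foldr shifted_deriv L f)"
  by (induction L) (auto intro: smooth_shifted_deriv)

lemma foldr_shifted_deriv_add:
  "smooth f \<Longrightarrow> smooth g \<Longrightarrow> foldr shifted_deriv L (\<lambda>x. f x + g x) =
    (\<lambda>x. foldr shifted_deriv L f x + foldr shifted_deriv L g x)"
  by (induction L) (auto simp: shifted_deriv_add smooth_foldr_shifted_deriv)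

lemma foldr_shifted_deriv_cmult:
  "smooth f \<Longrightarrow>
    foldr shifted_deriv L (\<lambda>x. c * f x) = (\<lambda>x. c * foldr shifted_deriv L f x)"
  by (induction L) (auto simp: shifted_deriv_cmult smooth_foldr_shifted_deriv)

lemma foldr_shifted_deriv_commute:
  "smooth f \<Longrightarrow>
    foldr shifted_deriv L (shifted_deriv l f) = shifted_deriv l (foldr shifted_deriv L f)"
  by (induction L) (auto simp: shifted_deriv_commute smooth_foldr_shifted_deriv)

text \<open>The operators commute, so only the multiplicities of the entries matter and lists may be
  rearranged freely.\<close>

lemma foldr_shifted_deriv_mset:
  assumes "smooth f" "mset L = mset M"
  shows "foldr shifted_deriv L f = foldr shifted_deriv M f"
  using assms(2)
proof (induction L arbitrary: M)
  case (Cons l L)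
  then have "l \<in> set M" by (metis list.set_intros(1) mset_eq_setD)
  then obtain M1 M2 where M: "M = M1 @ l # M2" by (meson split_list)
  have "foldr shifted_deriv L f = foldr shifted_deriv (M1 @ M2) f"
    using Cons.prems M by (intro Cons.IH) simp
  then show ?case
    using foldr_shifted_deriv_commute[OF smooth_foldr_shifted_deriv[OF assms(1)], of M1 l M2]
    by (simp add: M)
qed simp

section \<open>The solution spaces\<close>

lemma exp_poly_space_iff:
  "f \<in> exp_poly_space L \<longleftrightarrow> smooth f \<and> foldr shifted_deriv L f = (\<lambda>x. 0)"
  by (auto simp: exp_poly_space_def)

lemma exp_poly_space_smooth: "f \<in> exp_poly_space L \<Longrightarrow> smooth f"
  by (simp add: exp_poly_space_def)

text \<open>\<open>foldr\<close> applies the last entry first, so the inductions on the list peel it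
  from the right.\<close>

lemma exp_poly_space_snoc:
  "f \<in> exp_poly_space (L @ [l]) \<longleftrightarrow> smooth f \<and> shifted_deriv l f \<in> exp_poly_space L"
  by (auto simp: exp_poly_space_iff smooth_shifted_deriv)

lemma exp_poly_space_add:
  "f \<in> exp_poly_space L \<Longrightarrow> g \<in> exp_poly_space L \<Longrightarrow> (\<lambda>x. f x + g x) \<in> exp_poly_space L"
  by (auto simp: exp_poly_space_iff smooth_add foldr_shifted_deriv_add)

lemma exp_poly_space_cmult:
  "f \<in> exp_poly_space L \<Longrightarrow> (\<lambda>x. c * f x) \<in> exp_poly_space L"
  by (auto simp: exp_poly_space_iff smooth_cmult foldr_shifted_deriv_cmult)

lemma exp_poly_space_mono:
  assumes "f \<in> exp_poly_space L" "mset L \<subseteq># mset M"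
  shows "f \<in> exp_poly_space M"
proof -
  obtain K where "mset M = mset (K @ L)"
    using assms(2) by (metis ex_mset mset_append subset_mset.diff_add)
  then show ?thesis
    using assms(1) foldr_shifted_deriv_mset[of f M "K @ L"] by (auto simp: exp_poly_space_iff)
qed

text \<open>By the product rule, (d/dx - l)(x f) = x (d/dx - l) f + f. Induction handles the first
  summand; the second is covered because \<open>l\<close> occurs in \<open>M\<close>, so
  \<open>M @ L\<close> contains \<open>L @ [l]\<close> as a multiset.\<close>

lemma exp_poly_space_mult_x:
  assumes "f \<in> exp_poly_space L" "set L \<subseteq> set M"
  shows "(\<lambda>x. of_real x * f x) \<in> exp_poly_space (M @ L)"
  using assms
proof (induction L arbitrary: f rule: rev_induct)
  case Nil
  then have "f = (\<lambda>x. 0)" by (simp add: exp_poly_space_iff)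
  then show ?case using Nil by (simp add: exp_poly_space_iff)
next
  case (snoc l L)
  then have sm: "smooth f" and g: "shifted_deriv l f \<in> exp_poly_space L"
    by (auto simp: exp_poly_space_snoc)
  have "mset (L @ [l]) \<subseteq># mset (M @ L)"
    using snoc.prems(2) by simp
  with snoc.prems(1) have "f \<in> exp_poly_space (M @ L)"
    by (rule exp_poly_space_mono)
  moreover have "(\<lambda>x. of_real x * shifted_deriv l f x) \<in> exp_poly_space (M @ L)"
    using snoc.IH[OF g] snoc.prems(2) by simp
  ultimately have "shifted_deriv l (\<lambda>x. of_real x * f x) \<in> exp_poly_space (M @ L)"
    by (simp add: shifted_deriv_mult_x[OF sm] exp_poly_space_add)
  then show ?case
    using exp_poly_space_snoc[of _ "M @ L" l] by (simp add: smooth_mult_x sm)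
qed

section \<open>Counting zeros\<close>

lemma rolle_finite:
  fixes u u' :: "real \<Rightarrow> real"
  assumes der: "\<And>x. (u has_real_derivative u' x) (at x)"
    and "finite S" "S \<subseteq> {c..d}" "\<forall>x\<in>S. u x = 0"
  shows "\<exists>T. finite T \<and> T \<subseteq> {c<..<d} \<and> (\<forall>x\<in>T. u' x = 0) \<and> card S \<le> card T + 1"
  using assms(2-)
proof (induction S arbitrary: d rule: finite_linorder_max_induct)
  case empty
  then show ?case by (intro exI[of _ "{}"]) simp
next
  case (insert b A)
  show ?case
  proof (cases "A = {}")
    case True
    then show ?thesis by (intro exI[of _ "{}"]) simp
  next
    case False
    define m where "m = Max A"
    have m: "m \<in> A" using False insert.hyps(1) by (simp add: m_def)
    \<comment> \<open>With \<open>d\<close> replaced by \<open>m\<close>, the zeros from the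
      induction lie left of \<open>m\<close> and differ from the one found between \<open>m\<close>
      and \<open>b\<close>.\<close>
    have "A \<subseteq> {c..m}" using insert.prems(1) insert.hyps(1) by (auto simp: m_def)
    then obtain T where T: "finite T" "T \<subseteq> {c<..<m}" "\<forall>x\<in>T. u' x = 0" "card A \<le> card T + 1"
      using insert.IH[of m] insert.prems by auto
    have "m < b" using m insert.hyps by auto
    moreover have "u m = u b" using m insert.prems by auto
    moreover have "continuous_on {m..b} u"
      using der DERIV_continuous_on has_field_derivative_at_within by blast
    ultimately obtain z where z: "m < z" "z < b" "(\<lambda>v. u' z * v) = (\<lambda>v. 0)"
      using Rolle_deriv[of m b u "\<lambda>x v. u' x * v"] der
      by (auto simp: has_field_derivative_def)
    have "u' z = 0" using fun_cong[OF z(3), of 1] by simp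
    moreover have "z \<notin> T" using T z by auto
    moreover have "c \<le> m" "b \<le> d" using m insert.prems(1) by auto
    moreover have "card (insert b A) = Suc (card A)" using insert.hyps by auto
    ultimately show ?thesis
      using T z by (intro exI[of _ "insert z T"]) auto
  qed
qed

text \<open>Zeros are counted with multiplicity at the end points only. Rolle's theorem loses exactly one
  zero under this count, because the end point zeros whose order drops produce new interior zeros.\<close>

lemma Re_eq_zero_if_many_zeros:
  assumes "smooth f" "\<forall>x. Re (foldr shifted_deriv L f x) = 0"
    and "finite Z" "Z \<subseteq> {0<..<1}" "\<forall>z\<in>Z. Re (f z) = 0"
    and "\<forall>j<a. Re (nth_vderiv j f 0) = 0" "\<forall>j<b. Re (nth_vderiv j f 1) = 0"
    and "length L \<le> a + b + card Z"
  shows "Re (f x) = 0"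
  using assms
proof (induction L arbitrary: f a b Z x rule: rev_induct)
  case Nil
  then show ?case by simp
next
  case (snoc l L)
  define g where "g = shifted_deriv l f"
  \<comment> \<open>The factor makes the derivative of \<open>u\<close> a nonvanishing multiple of
    \<open>Re (g x)\<close>, so Rolle's theorem for \<open>u\<close> yields zeros of the real part
    of \<open>g\<close>.\<close>
  define u where "u = (\<lambda>x. exp (- l * x) * Re (f x))"
  define S where "S = Z \<union> (if a > 0 then {0} else {}) \<union> (if b > 0 then {1} else {})"
  have der: "(u has_real_derivative exp (- l * x) * Re (g x)) (at x)" for x
  proof -
    have "((\<lambda>x. Re (f x)) has_vector_derivative Re (nth_vderiv 1 f x)) (at x)"
      using smooth_has_vderiv_0[OF snoc.prems(1)]
      by (rule bounded_linear.has_vector_derivative[OF bounded_linear_Re])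
    then have 1: "((\<lambda>x. Re (f x)) has_real_derivative Re (nth_vderiv 1 f x)) (at x)"
      by (simp add: has_real_derivative_iff_has_vector_derivative)
    have 2: "((\<lambda>x. exp (- l * x)) has_real_derivative - l * exp (- l * x)) (at x)"
      by (auto intro!: derivative_eq_intros)
    show ?thesis
      unfolding u_def g_def shifted_deriv_eq
      by (rule DERIV_cong[OF DERIV_mult[OF 2 1]]) (simp add: algebra_simps)
  qed
  have S: "finite S" "S \<subseteq> {0..1}"
    using snoc.prems(3,4) by (auto simp: S_def)
  have "a > 0 \<longrightarrow> Re (f 0) = 0" "b > 0 \<longrightarrow> Re (f 1) = 0"
    using snoc.prems(6,7) by (metis nth_vderiv_0)+
  then have uS: "\<forall>x\<in>S. u x = 0"
    using snoc.prems(5) by (auto simp: S_def u_def)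
  have cardS: "card S = card Z + (if a > 0 then 1 else 0) + (if b > 0 then 1 else 0)"
  proof -
    have "0 \<notin> Z" "1 \<notin> Z" using snoc.prems(4) by auto
    then show ?thesis using snoc.prems(3) by (simp add: S_def)
  qed
  obtain T where T: "finite T" "T \<subseteq> {0<..<1}" "\<forall>x\<in>T. Re (g x) = 0" "card S \<le> card T + 1"
    using rolle_finite[OF der S uS] by auto
  have g0: "Re (g x) = 0" for x
  proof (rule snoc.IH)
    show "smooth g" unfolding g_def by (rule smooth_shifted_deriv[OF snoc.prems(1)])
    show "\<forall>x. Re (foldr shifted_deriv L g x) = 0" using snoc.prems(2) by (simp add: g_def)
    \<comment> \<open>Each positive end point order drops by one; \<open>T\<close> makes up for this
      except for a single zero, matching the shorter list.\<close>
    show "\<forall>j<a - 1. Re (nth_vderiv j g 0) = 0" "\<forall>j<b - 1. Re (nth_vderiv j g 1) = 0"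
      using snoc.prems(6,7) by (auto simp: g_def nth_vderiv_shifted_deriv[OF snoc.prems(1)])
    show "length L \<le> a - 1 + (b - 1) + card T"
      using snoc.prems(8) T(4) cardS by (auto split: if_splits)
  qed (use T in auto)
  \<comment> \<open>\<open>u\<close> is constant, so one zero suffices; it exists because the list
    \<open>L @ [l]\<close> is nonempty.\<close>
  have "S \<noteq> {}" using snoc.prems(8) cardS by (auto split: if_splits)
  then obtain y where "u y = 0" using uS by blast
  moreover have "u x = u y"
    using der g0 by (intro DERIV_isconst_all) simp
  ultimately show ?case by (simp add: u_def)
qed

text \<open>The zero count concerns real parts; applying it to f and to -i f, whose real part is Im
  f, settles complex values.\<close>

lemma exp_poly_space_eq_zero:
  assumes f: "f \<in> exp_poly_space L"
    and "\<forall>j<a. nth_vderiv j f 0 = 0" "\<forall>j<b. nth_vderiv j f 1 = 0" "length L \<le> a + b"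
  shows "f = (\<lambda>x. 0)"
proof
  fix x
  have Re0: "Re (c * f x) = 0" for c
    by (rule Re_eq_zero_if_many_zeros[where L = L and Z = "{}" and a = a and b = b])
      (use assms exp_poly_space_cmult[OF f, of c] exp_poly_space_smooth[OF f] in
        \<open>auto simp: exp_poly_space_iff nth_vderiv_cmult\<close>)
  show "f x = 0" using Re0[of 1] Re0[of "- \<i>"] by (simp add: complex_eq_iff)
qed

section \<open>Existence of the basis functions\<close>

lemma
  assumes "smooth g" and f: "\<And>x. (f has_vector_derivative of_real l * f x + g x) (at x)"
  shows smooth_ode_solution: "smooth f" and shifted_deriv_ode_solution: "shifted_deriv l f = g"
proof -
  \<comment> \<open>Differentiating f' = l f + g repeatedly expresses each derivative by the
    preceding one.\<close>
  define F where "F = rec_nat f (\<lambda>j h x. of_real l * h x + nth_vderiv j g x)"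
  have "(F j has_vector_derivative F (Suc j) x) (at x)" for j x
  proof (induction j)
    case 0
    then show ?case using f by (simp add: F_def)
  next
    case (Suc j)
    have "F (Suc i) = (\<lambda>x. of_real l * F i x + nth_vderiv i g x)" for i by (simp add: F_def)
    then show ?case
      using has_vector_derivative_add[OF has_vector_derivative_mult_right[OF Suc, of "of_real l"]
          smooth_has_vderiv[OF assms(1), of j x]] by simp
  qed
  then show "smooth f" using smooth_family[of F] by (simp add: F_def)
  show "shifted_deriv l f = g"
    using vector_derivative_at[OF f] by (simp add: shifted_deriv_def)
qed

text \<open>Since f^(j+1) = l f^(j) + (f' - l f)^(j), a single zero value of \<open>f\<close> gains
  one order over \<open>shifted_deriv l f\<close>.\<close>

lemma ode_solution_vanishing_order:
  assumes "smooth f" "f c = 0" "\<forall>j<a - 1. nth_vderiv j (shifted_deriv l f) c = 0"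
  shows "\<forall>j<a. nth_vderiv j f c = 0"
proof (intro allI impI)
  fix j assume "j < a"
  then show "nth_vderiv j f c = 0"
  proof (induction j)
    case 0
    then show ?case using assms(2) by simp
  next
    case (Suc j)
    moreover have "nth_vderiv j (shifted_deriv l f) c = 0" using Suc.prems assms(3) by simp
    ultimately show ?case by (simp add: nth_vderiv_shifted_deriv[OF assms(1)])
  qed
qed

lemma weighted_antiderivative_exists:
  assumes "smooth g"
  obtains F where "\<And>x. (F has_vector_derivative exp (- of_real (l * x)) * g x) (at x)"
proof -
  have "continuous (at x) g" for x
    using smooth_has_vderiv_0[OF assms] has_vector_derivative_continuous by blast
  then have "\<exists>F. \<forall>x. -\<infinity> < ereal x \<longrightarrow> ereal x < \<infinity> \<longrightarrow>
      (F has_vector_derivative exp (- of_real (l * x)) * g x) (at x)"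
    by (intro einterval_antiderivative) (auto intro!: continuous_intros)
  then show ?thesis using that by auto
qed

text \<open>The constant \<open>c\<close> is free, and the solution vanishes exactly where
  \<open>F\<close> takes the value \<open>c\<close>.\<close>

lemma variation_of_constants:
  fixes F g :: "real \<Rightarrow> complex"
  assumes "(F has_vector_derivative exp (- of_real (l * x)) * g x) (at x)"
  shows "((\<lambda>x. exp (of_real (l * x)) * (F x - c)) has_vector_derivative
    of_real l * (exp (of_real (l * x)) * (F x - c)) + g x) (at x)"
proof -
  have "((\<lambda>x. exp (of_real (l * x)) :: complex) has_vector_derivative
      of_real l * exp (of_real (l * x))) (at x)"
  proof -
    have "((\<lambda>x. exp (l * x)) has_real_derivative l * exp (l * x)) (at x)"
      by (auto intro!: derivative_eq_intros)
    then have "((\<lambda>x. of_real (exp (l * x)) :: complex) has_vector_derivative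
        of_real (l * exp (l * x))) (at x)"
      by (rule has_vector_derivative_of_real)
    then show ?thesis by (simp only: exp_of_real of_real_mult[symmetric])
  qed
  moreover have "((\<lambda>x. F x - c) has_vector_derivative exp (- of_real (l * x)) * g x) (at x)"
    using has_vector_derivative_diff[OF assms has_vector_derivative_const] by simp
  ultimately show ?thesis
    by (rule has_vector_derivative_mult[THEN has_vector_derivative_eq_rhs])
      (simp add: exp_minus field_simps)
qed

text \<open>These are \<open>a + b\<close> linear conditions on a space of dimension
  \<open>a + b + 1\<close>; instead of a dimension count, the function is built by induction on the
  list.\<close>

lemma exists_nonzero_with_zeros:
  assumes "length L = Suc (a + b)"
  shows "\<exists>f \<in> exp_poly_space L. f \<noteq> (\<lambda>x. 0) \<and>
    (\<forall>j<a. nth_vderiv j f 0 = 0) \<and> (\<forall>j<b. nth_vderiv j f 1 = 0)"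
  using assms
proof (induction L arbitrary: a b rule: rev_induct)
  case Nil
  then show ?case by simp
next
  case (snoc l L)
  text \<open>It suffices to find \<open>g\<close> whose antiderivative \<open>\<integral> exp (- l t) g t dt\<close> has a common
    value at the end points where \<open>f\<close> must vanish.\<close>
  have lift: ?case
    if g: "g \<in> exp_poly_space L"
      and F: "\<And>x. (F has_vector_derivative exp (- of_real (l * x)) * g x) (at x)"
      and z: "\<forall>j<a - 1. nth_vderiv j g 0 = 0" "\<forall>j<b - 1. nth_vderiv j g 1 = 0"
      and c: "a > 0 \<longrightarrow> F 0 = c" "b > 0 \<longrightarrow> F 1 = c"
      and nz: "F \<noteq> (\<lambda>x. c)" for g F c
  proof -
    define f where "f = (\<lambda>x. exp (of_real (l * x)) * (F x - c))"
    have "(f has_vector_derivative of_real l * f x + g x) (at x)" for x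
      unfolding f_def by (rule variation_of_constants[OF F])
    then have f: "smooth f" "shifted_deriv l f = g"
      using smooth_ode_solution shifted_deriv_ode_solution exp_poly_space_smooth[OF g] by blast+
    have "\<forall>j<a. nth_vderiv j f 0 = 0"
    proof (cases "a = 0")
      case False
      then have "f 0 = 0" using c by (simp add: f_def)
      then show ?thesis using ode_solution_vanishing_order[of f 0 a l] f z by simp
    qed simp
    moreover have "\<forall>j<b. nth_vderiv j f 1 = 0"
    proof (cases "b = 0")
      case False
      then have "f 1 = 0" using c by (simp add: f_def)
      then show ?thesis using ode_solution_vanishing_order[of f 1 b l] f z by simp
    qed simp
    moreover have "f \<in> exp_poly_space (L @ [l])" using f g by (simp add: exp_poly_space_snoc)
    moreover have "f \<noteq> (\<lambda>x. 0)" using nz by (auto simp: f_def fun_eq_iff)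
    ultimately show ?thesis by blast
  qed
  have F_nonconst: "F \<noteq> (\<lambda>x. c)"
    if "\<And>x. (F has_vector_derivative exp (- of_real (l * x)) * g x) (at x)" "g \<noteq> (\<lambda>x. 0)"
    for F g :: "real \<Rightarrow> complex" and c
  proof
    assume "F = (\<lambda>x. c)"
    then have "exp (- of_real (l * x)) * g x = 0" for x
      using that(1)[of x] has_vector_derivative_const[of c "at x"]
        vector_derivative_unique_at by metis
    then show False using that(2) by (auto simp: fun_eq_iff)
  qed
  show ?case
  proof (cases "a > 0 \<and> b > 0")
    case True
    \<comment> \<open>Zeros of \<open>f\<close> at both ends force \<open>F 0 = F 1\<close>, one
      linear condition on \<open>g\<close>. Two candidates, each with one zero more than
      \<open>g\<close> needs at one end, leave room to meet it.\<close>
    obtain g1 where g1: "g1 \<in> exp_poly_space L" "g1 \<noteq> (\<lambda>x. 0)"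
      "\<forall>j<a - 1. nth_vderiv j g1 0 = 0" "\<forall>j<b. nth_vderiv j g1 1 = 0"
      using snoc.IH[of "a - 1" b] snoc.prems True by auto
    obtain g2 where g2: "g2 \<in> exp_poly_space L" "g2 \<noteq> (\<lambda>x. 0)"
      "\<forall>j<a. nth_vderiv j g2 0 = 0" "\<forall>j<b - 1. nth_vderiv j g2 1 = 0"
      using snoc.IH[of a "b - 1"] snoc.prems True by auto
    note sm = exp_poly_space_smooth[OF g1(1)] exp_poly_space_smooth[OF g2(1)]
    obtain F1 where F1: "\<And>x. (F1 has_vector_derivative exp (- of_real (l * x)) * g1 x) (at x)"
      using weighted_antiderivative_exists sm by blast
    obtain F2 where F2: "\<And>x. (F2 has_vector_derivative exp (- of_real (l * x)) * g2 x) (at x)"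
      using weighted_antiderivative_exists sm by blast
    obtain \<alpha> \<beta> where \<alpha>\<beta>: "\<alpha> * (F1 1 - F1 0) + \<beta> * (F2 1 - F2 0) = 0" "\<alpha> \<noteq> 0 \<or> \<beta> \<noteq> 0"
    proof (cases "F1 1 - F1 0 = 0")
      case True
      then show ?thesis using that[of 1 0] by simp
    next
      case False
      then show ?thesis using that[of "- (F2 1 - F2 0)" "F1 1 - F1 0"] by (simp add: algebra_simps)
    qed
    define g where "g = (\<lambda>x. \<alpha> * g1 x + \<beta> * g2 x)"
    define F where "F = (\<lambda>x. \<alpha> * F1 x + \<beta> * F2 x)"
    have der_g: "nth_vderiv j g = (\<lambda>x. \<alpha> * nth_vderiv j g1 x + \<beta> * nth_vderiv j g2 x)" for j
      unfolding g_def by (simp add: nth_vderiv_add nth_vderiv_cmult smooth_cmult sm)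
    have der_F: "(F has_vector_derivative exp (- of_real (l * x)) * g x) (at x)" for x
      unfolding F_def g_def
      by (rule has_vector_derivative_add[OF has_vector_derivative_mult_right[OF F1]
            has_vector_derivative_mult_right[OF F2], THEN has_vector_derivative_eq_rhs])
        (simp add: algebra_simps)
    have "g \<noteq> (\<lambda>x. 0)"
    proof
      assume g0: "g = (\<lambda>x. 0)"
      have zero: "nth_vderiv j (\<lambda>x. 0) = (\<lambda>x. 0)" for j
        using nth_vderiv_cmult[OF sm(1), of j 0] by simp
      \<comment> \<open>A further zero would give \<open>g1\<close> as many zeros as
        \<open>L\<close> has entries. As \<open>g2\<close> vanishes to order \<open>a\<close>, the
        two are independent.\<close>
      have "nth_vderiv (a - 1) g1 0 \<noteq> 0"
      proof
        assume "nth_vderiv (a - 1) g1 0 = 0"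
        then have "\<forall>j<a. nth_vderiv j g1 0 = 0"
          using g1(3) by (metis Suc_diff_1 True less_Suc_eq)
        then show False
          using exp_poly_space_eq_zero[OF g1(1) _ g1(4), of a] g1(2) snoc.prems by auto
      qed
      moreover have "\<alpha> * nth_vderiv (a - 1) g1 0 = 0"
        using fun_cong[OF der_g[of "a - 1"], of 0] g0 g2(3) True by (simp add: zero)
      ultimately have "\<alpha> = 0" by simp
      then have "g2 = (\<lambda>x. 0)" using g0 \<alpha>\<beta>(2) by (auto simp: g_def fun_eq_iff)
      then show False using g2(2) by simp
    qed
    with der_F have "F \<noteq> (\<lambda>x. F 0)" by (rule F_nonconst)
    moreover have "g \<in> exp_poly_space L"
      unfolding g_def by (intro exp_poly_space_add exp_poly_space_cmult g1 g2)
    moreover have "F 1 = F 0" using \<alpha>\<beta>(1) by (simp add: F_def algebra_simps)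
    ultimately show ?thesis
      using der_F g1 g2 by (intro lift[of g F "F 0"]) (auto simp: der_g)
  next
    case False
    show ?thesis
    proof (cases "a + b = 0")
      case True
      then have "L = []" using snoc.prems by simp
      then show ?thesis
        \<comment> \<open>Only \<open>g = 0\<close> is available here, so \<open>F_nonconst\<close>
          does not apply; \<open>F = 1\<close> and \<open>c = 0\<close> give f(x) = exp(l
          x).\<close>
        using True by (intro lift[of "\<lambda>x. 0" "\<lambda>x. 1" 0])
          (auto simp: exp_poly_space_iff fun_eq_iff
            intro: smooth_family[of "\<lambda>_ _. 0"])
    next
      case ab: False
      obtain g where g: "g \<in> exp_poly_space L" "g \<noteq> (\<lambda>x. 0)"
        "\<forall>j<a - 1. nth_vderiv j g 0 = 0" "\<forall>j<b - 1. nth_vderiv j g 1 = 0"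
        using snoc.IH[of "a - 1" "b - 1"] snoc.prems ab False by auto
      obtain F where F: "\<And>x. (F has_vector_derivative exp (- of_real (l * x)) * g x) (at x)"
        using weighted_antiderivative_exists exp_poly_space_smooth[OF g(1)] by blast
      show ?thesis
        \<comment> \<open>Zeros are required at one end only, so \<open>c\<close> can be the value
          of \<open>F\<close> there.\<close>
        using False by (intro lift[OF g(1) F g(3,4), of "if a > 0 then F 0 else F 1"]
            F_nonconst[OF F g(2)]) auto
    qed
  qed
qed

text \<open>One more zero at either end would exceed the zero count, so both orders are exact and
  \<open>f\<close> can be rescaled. Two normalized solutions differ by a function with the extra
  zero at 0, hence agree.\<close>

lemma basis_fun_ex1:
  assumes "k < length L"
  shows "\<exists>!f. f \<in> exp_poly_space L \<and> zero_of_exact_order f 0 k \<and>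
    zero_of_exact_order f 1 (length L - 1 - k) \<and> nth_vderiv k f 0 = 1"
proof -
  define b where "b = length L - 1 - k"
  have len: "length L = Suc (k + b)" using assms by (simp add: b_def)
  obtain f where f: "f \<in> exp_poly_space L" "f \<noteq> (\<lambda>x. 0)"
    "\<forall>j<k. nth_vderiv j f 0 = 0" "\<forall>j<b. nth_vderiv j f 1 = 0"
    using exists_nonzero_with_zeros[OF len] by auto
  have k0: "nth_vderiv k f 0 \<noteq> 0"
    using exp_poly_space_eq_zero[OF f(1) _ f(4), of "Suc k"] f(2,3) len
    by (auto simp: less_Suc_eq)
  have b1: "nth_vderiv b f 1 \<noteq> 0"
    using exp_poly_space_eq_zero[OF f(1,3), of "Suc b"] f(2,4) len
    by (auto simp: less_Suc_eq)
  define p where "p = (\<lambda>x. inverse (nth_vderiv k f 0) * f x)"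
  have der_p: "nth_vderiv j p = (\<lambda>x. inverse (nth_vderiv k f 0) * nth_vderiv j f x)" for j
    unfolding p_def by (rule nth_vderiv_cmult[OF exp_poly_space_smooth[OF f(1)]])
  show ?thesis
    unfolding b_def[symmetric]
  proof (rule ex1I[of _ p])
    show "p \<in> exp_poly_space L \<and> zero_of_exact_order p 0 k \<and> zero_of_exact_order p 1 b \<and>
        nth_vderiv k p 0 = 1"
      using f k0 b1 exp_poly_space_cmult[OF f(1), of "inverse (nth_vderiv k f 0)"]
      by (auto simp: zero_of_exact_order_def der_p simp flip: p_def)
  next
    fix h
    assume h: "h \<in> exp_poly_space L \<and> zero_of_exact_order h 0 k \<and> zero_of_exact_order h 1 b \<and>
      nth_vderiv k h 0 = 1"
    define e where "e = - inverse (nth_vderiv k f 0)"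
    let ?d = "\<lambda>x. h x + e * f x"
    have d: "nth_vderiv j ?d = (\<lambda>x. nth_vderiv j h x + e * nth_vderiv j f x)" for j
    proof -
      have "smooth h" "smooth f" using h f(1) exp_poly_space_smooth by blast+
      then show ?thesis by (simp add: nth_vderiv_add nth_vderiv_cmult smooth_cmult)
    qed
    have "?d = (\<lambda>x. 0)"
    proof (rule exp_poly_space_eq_zero)
      show "?d \<in> exp_poly_space L"
        using h f(1) by (intro exp_poly_space_add exp_poly_space_cmult) auto
      show "\<forall>j<Suc k. nth_vderiv j ?d 0 = 0"
        unfolding d using h f(3) k0 by (auto simp: zero_of_exact_order_def less_Suc_eq e_def)
      show "\<forall>j<b. nth_vderiv j ?d 1 = 0"
        unfolding d using h f(4) by (auto simp: zero_of_exact_order_def)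
    qed (use len in simp)
    then show "h = p" by (simp add: p_def e_def fun_eq_iff)
  qed
qed

lemma basis_fun_props:
  assumes "k < length L"
  shows "basis_fun L k \<in> exp_poly_space L"
    and "\<And>j. j < k \<Longrightarrow> nth_vderiv j (basis_fun L k) 0 = 0"
    and "\<And>j. j + k + 1 < length L \<Longrightarrow> nth_vderiv j (basis_fun L k) 1 = 0"
    and "nth_vderiv k (basis_fun L k) 0 = 1"
  using theI'[OF basis_fun_ex1[OF assms]] by (auto simp: basis_fun_def zero_of_exact_order_def)

section \<open>The recursion formula\<close>

lemma p_odd_props:
  assumes "k \<le> 2 * m + 1"
  shows "p_odd lam mu m k \<in> exp_poly_space (replicate (m + 1) lam @ replicate (m + 1) mu)"
    and "\<And>j. j < k \<Longrightarrow> nth_vderiv j (p_odd lam mu m k) 0 = 0"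
    and "\<And>j. j + k < 2 * m + 1 \<Longrightarrow> nth_vderiv j (p_odd lam mu m k) 1 = 0"
    and "nth_vderiv k (p_odd lam mu m k) 0 = 1"
  using basis_fun_props[of k "replicate (m + 1) lam @ replicate (m + 1) mu"] assms
  unfolding p_odd_def by auto

lemma exp_poly_space_two_mult_x:
  assumes "f \<in> exp_poly_space (replicate m lam @ replicate m mu)"
  shows "(\<lambda>x. of_real x * f x) \<in> exp_poly_space (replicate (Suc m) lam @ replicate (Suc m) mu)"
proof -
  have "(\<lambda>x. of_real x * f x) \<in> exp_poly_space ([lam, mu] @ replicate m lam @ replicate m mu)"
    using assms by (rule exp_poly_space_mult_x) auto
  then show ?thesis by (rule exp_poly_space_mono) simp
qed

theorem theorem28:
  fixes lam mu :: real and s k :: nat and x :: real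
  assumes "s \<ge> 2" and "k \<le> 2 * s - 3"
  shows "A_const lam mu s k * p_odd lam mu s (k + 4) x =
      of_real x ^ 2 * p_odd lam mu (s - 2) k x
      - of_nat ((k + 1) * (k + 2)) * p_odd lam mu (s - 1) (k + 2) x
      + B_const lam mu s k * of_real x * p_odd lam mu (s - 1) (k + 2) x"
proof -
  define t where "t = s - 2"
  have s: "s = t + 2" "s - 1 = t + 1" "s - 2 = t" using assms(1) by (simp_all add: t_def)
  have k: "k \<le> 2 * t + 1" using assms by (simp add: s)
  define p where "p = p_odd lam mu t k"
  define q where "q = p_odd lam mu (t + 1) (k + 2)"
  define r where "r = p_odd lam mu (t + 2) (k + 4)"
  define A where "A = A_const lam mu s k"
  define B where "B = B_const lam mu s k"
  \<comment> \<open>The index is the common multiplicity, so \<open>E m\<close> belongs to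
    Lambda_(2m-1).\<close>
  define E where "E = (\<lambda>m. exp_poly_space (replicate m lam @ replicate m mu))"
  note p = p_odd_props[OF k, where lam = lam and mu = mu, folded p_def]
  have "k + 2 \<le> 2 * (t + 1) + 1" using k by simp
  note q = p_odd_props[OF this, where lam = lam and mu = mu, folded q_def]
  have "k + 4 \<le> 2 * (t + 2) + 1" using k by simp
  note r = p_odd_props[OF this, where lam = lam and mu = mu, folded r_def]
  note sm = exp_poly_space_smooth[OF p(1)] exp_poly_space_smooth[OF q(1)]
    exp_poly_space_smooth[OF r(1)]
  define c where "c = (of_nat ((k + 1) * (k + 2)) :: complex)"
  \<comment> \<open>Right side minus left side, with differences written as negated coefficients to
    fit the rules for sums and multiples.\<close>
  define h where "h = (\<lambda>x. of_real x * (of_real x * p x) + ((- c) * q x +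
    (B * (of_real x * q x) + (- A) * r x)))"
  have der: "nth_vderiv j h x =
      of_real x * (of_real x * nth_vderiv j p x + of_nat j * nth_vderiv (j - 1) p x)
      + of_nat j * (of_real x * nth_vderiv (j - 1) p x
          + of_nat (j - 1) * nth_vderiv (j - 1 - 1) p x)
      - c * nth_vderiv j q x
      + B * (of_real x * nth_vderiv j q x + of_nat j * nth_vderiv (j - 1) q x)
      - A * nth_vderiv j r x" for j x
  proof -
    note * = smooth_add smooth_cmult smooth_mult_x sm
    show ?thesis
      unfolding h_def
      by (subst nth_vderiv_add, (intro *)+)+
        (simp only: nth_vderiv_mult_x nth_vderiv_cmult *, simp)
  qed
  have "h = (\<lambda>x. 0)"
  proof (rule exp_poly_space_eq_zero)
    have "p \<in> E (t + 1)" "q \<in> E (t + 2)" "r \<in> E (t + 3)"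
      using p(1) q(1) r(1) by (simp_all add: E_def eval_nat_numeral)
    moreover have "f \<in> E (t + 3)" if "f \<in> E (t + 2)" for f
      using that unfolding E_def
      by (rule exp_poly_space_mono) (auto simp: eval_nat_numeral intro: subset_mset.add_mono)
    moreover have mx: "(\<lambda>x. of_real x * f x) \<in> E (Suc m)" if "f \<in> E m" for f m
      using that unfolding E_def by (rule exp_poly_space_two_mult_x)
    ultimately have "(\<lambda>x. of_real x * (of_real x * p x)) \<in> E (t + 3)" "q \<in> E (t + 3)"
        "(\<lambda>x. of_real x * q x) \<in> E (t + 3)" "r \<in> E (t + 3)"
      using mx[OF mx[of p "t + 1"]] mx[of q "t + 2"] by (simp_all add: eval_nat_numeral)
    then have "h \<in> E (t + 3)"
      unfolding h_def E_def by (intro exp_poly_space_add exp_poly_space_cmult)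
    then show "h \<in> exp_poly_space (replicate (t + 3) lam @ replicate (t + 3) mu)"
      by (simp add: E_def)
    \<comment> \<open>\<open>p\<close>, \<open>q\<close> and \<open>r\<close> all have this same
      order at 1, since raising \<open>m\<close> by 1 and \<open>k\<close> by 2 leaves 2m + 1 - k
      unchanged.\<close>
    show "\<forall>j<2 * t + 1 - k. nth_vderiv j h 1 = 0"
      using p(3) q(3) r(3) by (auto simp: der)
    show "\<forall>j<k + 5. nth_vderiv j h 0 = 0"
    proof (intro allI impI)
      fix j assume "j < k + 5"
      \<comment> \<open>All terms of \<open>h\<close> vanish below order \<open>k + 2\<close>, where
        the normalizations of \<open>p\<close> and \<open>q\<close> cancel. Orders
        \<open>k + 3\<close> and \<open>k + 4\<close> determine \<open>B\<close> and then
        \<open>A\<close>.\<close>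
      then consider "j < k + 2" | "j = k + 2" | "j = k + 3" | "j = k + 4" by linarith
      then show "nth_vderiv j h 0 = 0"
      proof cases
        case 1
        \<comment> \<open>For \<open>j \<le> 1\<close> the truncated index \<open>j - 1 - 1\<close>
          is 0, where \<open>p\<close> may be nonzero, but the coefficient j (j - 1)
          vanishes.\<close>
        then show ?thesis using p(2) q(2) q(2)[of 0] r(2) r(2)[of 0]
          by (cases "j \<le> 1") (auto simp: der le_Suc_eq)
      next
        case 2
        then show ?thesis using p(4) q(2,4) r(2)
          by (simp add: der c_def algebra_simps)
      next
        case 3
        have nz: "of_nat (k + 3) \<noteq> (0::complex)" unfolding of_nat_eq_0_iff by simp
        have "of_nat (k + 3) * B = of_nat (k + 2) *
            (of_nat (k + 1) * nth_vderiv (k + 3) q 0 - of_nat (k + 3) * nth_vderiv (k + 1) p 0)"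
          using nz unfolding B_def B_const_def s p_def q_def
          by (simp del: of_nat_add)
        then show ?thesis using 3 q(4) r(2)
          by (simp add: der c_def algebra_simps)
      next
        case 4
        have "A = of_nat ((k + 3) * (k + 4)) * nth_vderiv (k + 2) p 0
            - c * nth_vderiv (k + 4) q 0 + of_nat (k + 4) * nth_vderiv (k + 3) q 0 * B"
          unfolding A_def A_const_def B_def s p_def q_def c_def by simp
        then show ?thesis using 4 r(4)
          by (simp add: der algebra_simps)
      qed
    qed
  qed (use k in simp)
  then have "h x = 0" by simp
  moreover have "p_odd lam mu s (k + 4) = r" by (simp add: r_def s(1))
  ultimately show ?thesis
    unfolding A_def[symmetric] B_def[symmetric]
    unfolding s(2,3) p_def[symmetric] q_def[symmetric] c_def[symmetric]
    by (simp add: h_def power2_eq_square algebra_simps)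
qed

end
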